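(* Every locally finite, connected, claw-free and net-free graph has at most two ends.
   Context: Graphs are undirected and simple, finite or infinite. A graph is locally finite if every vertex has finite degree. A graph is $H$-free if it has no induced subgraph isomorphic to $H$. The claw is $K_{1,3}$. The net is the graph on six vertices obtained from a triangle by attaching one new pendant (degree $1$) vertex to each of the three vertices of the triangle. A ray is a one-way infinite path; two rays in $G$ are equivalent if for every finite $S\subseteq V(G)$ they have tails in the same component of $G-S$; the equivalence classes are the ends of $G$. *)

theory Defs
  imports "Graph_Theory.Pair_Digraph" "Graph_Theory.Digraph_Component" "Graph_Theory.Digraph_Isomorphism"
begin

text \<open>
  A simple undirected graph, finite or infinite, is a \<^const>\<open>pair_bidirected_digraph\<close>: a symmetric
  irreflexive set of arcs on the vertex set, each undirected edge being a pair of opposite arcs.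
\<close>

text \<open>
  Since each edge at \<open>v\<close> contributes exactly one arc leaving \<open>v\<close>, the degree of \<open>v\<close> is the size of
  \<^term>\<open>out_arcs (with_proj G) v\<close>. Its cardinality \<^const>\<open>out_degree\<close> is \<open>0\<close> when that set is infinite,
  so finiteness has to be stated for the set.
\<close>
definition locally_finite_graph :: "'a pair_pre_digraph \<Rightarrow> bool" where
  "locally_finite_graph G \<longleftrightarrow> (\<forall>v \<in> pverts G. finite (out_arcs (with_proj G) v))"

definition induced_free :: "'b pair_pre_digraph \<Rightarrow> 'a pair_pre_digraph \<Rightarrow> bool" where
  "induced_free H G \<longleftrightarrow>
     \<not> (\<exists>K. induced_subgraph K (with_proj G) \<and> digraph_iso K (with_proj H))"

definition claw_graph :: "nat pair_pre_digraph" where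
  "claw_graph = mk_symmetric (with_proj
     \<lparr>pverts = {0, 1, 2, 3}, parcs = {(0, 1), (0, 2), (0, 3)}\<rparr>)"

definition net_graph :: "nat pair_pre_digraph" where
  "net_graph = mk_symmetric (with_proj
     \<lparr>pverts = {0, 1, 2, 3, 4, 5},
      parcs = {(0, 1), (1, 2), (2, 0), (0, 3), (1, 4), (2, 5)}\<rparr>)"

text \<open>
  A ray is represented by its sequence of vertices, read from its starting vertex.
\<close>
definition rays :: "'a pair_pre_digraph \<Rightarrow> (nat \<Rightarrow> 'a) set" where
  "rays G = {r. inj r \<and> range r \<subseteq> pverts G \<and> (\<forall>n. (r n, r (Suc n)) \<in> parcs G)}"

text \<open>
  The arc set being symmetric, the strong components of \<open>G - S\<close> are its components.
\<close>
definition components_minus :: "'a pair_pre_digraph \<Rightarrow> 'a set \<Rightarrow> 'a set set" where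
  "components_minus G S = pre_digraph.sccs_verts (with_proj G \<restriction> (pverts G - S))"

definition ray_equiv :: "'a pair_pre_digraph \<Rightarrow> ((nat \<Rightarrow> 'a) \<times> (nat \<Rightarrow> 'a)) set" where
  "ray_equiv G = {(r, s). r \<in> rays G \<and> s \<in> rays G \<and>
     (\<forall>S. finite S \<and> S \<subseteq> pverts G \<longrightarrow>
        (\<exists>C \<in> components_minus G S. \<exists>m n. r ` {m..} \<subseteq> C \<and> s ` {n..} \<subseteq> C))}"

definition graph_ends :: "'a pair_pre_digraph \<Rightarrow> (nat \<Rightarrow> 'a) set set" where
  "graph_ends G = rays G // ray_equiv G"

end

theory Submission
  imports Defs
begin

text \<open>
  Suppose three rays are pairwise inequivalent. A finite set of vertices separates their tails from
  each other, and since \<open>G\<close> is connected this set can be enlarged to a finite set \<open>T\<close> that induces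
  a connected subgraph. Each of the three components of \<open>G - T\<close> that contain the tails is infinite,
  whereas by local finiteness only finitely many of its vertices have a neighbour in \<open>T\<close>. So one can
  leave \<open>T\<close> into the \<open>i\<close>-th component along a path of length two, through a vertex \<open>y i\<close> adjacent to
  \<open>T\<close> to a vertex \<open>x i\<close> not adjacent to \<open>T\<close> (\<open>exit_path\<close>).
  Call this configuration, a finite connected
  set with three such legs and no edges between different legs (except possibly between their far ends),
  a tripod.

  Claw-free and net-free graphs contain no tripod (\<open>no_tripod\<close>), by induction on the size of \<open>T\<close>. If
  \<open>T\<close> is a single vertex, it is the centre of a claw. Otherwise \<open>T\<close> has two vertices \<open>t\<close>, \<open>t'\<close> whose
  removal leaves \<open>T\<close> connected. If each \<open>y i\<close> keeps a neighbour when \<open>t\<close> is removed, then \<open>T - {t}\<close>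
  is the body of a smaller tripod. If \<open>t\<close> is the only neighbour in \<open>T\<close> of \<open>y i\<close> and is not adjacent
  to the other two \<open>y j\<close>, then \<open>t\<close> can be moved from the body into the \<open>i\<close>-th leg, where
  \<open>t, y i\<close> replace \<open>y i, x i\<close>; this again gives a smaller tripod. Otherwise \<open>t\<close> is the only neighbour
  of one leg \<open>i\<close> and a neighbour of another leg \<open>j\<close>, and likewise \<open>t'\<close> for \<open>i'\<close> and \<open>j'\<close>. As there are
  only three legs, \<open>j = j'\<close>. If \<open>t\<close> and \<open>t'\<close> are not adjacent, then \<open>y j\<close> is the centre of a claw with
  leaves \<open>x j\<close>, \<open>t\<close>, \<open>t'\<close>; if they are, the triangle \<open>t, t', y j\<close> and the pendant vertices \<open>y i\<close>,
  \<open>y i'\<close>, \<open>x j\<close> form a net.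
\<close>

section \<open>Connected vertex sets\<close>

text \<open>
  Connectedness is phrased by cuts instead of paths: the induction below adds and removes single
  vertices, and cuts make it immediate that adding a neighbour keeps a set connected.
\<close>
definition connected_set :: "'a rel \<Rightarrow> 'a set \<Rightarrow> bool" where
  "connected_set E T \<longleftrightarrow>
     T \<noteq> {} \<and> (\<forall>B. B \<noteq> {} \<and> B \<subset> T \<longrightarrow> (\<exists>u\<in>B. \<exists>v\<in>T - B. (u, v) \<in> E))"

lemma connected_set_singleton: "connected_set E {a}"
  by (auto simp: connected_set_def)

lemma connected_set_edge:
  assumes "connected_set E T" "B \<noteq> {}" "B \<subset> T"
  obtains u v where "u \<in> B" "v \<in> T - B" "(u, v) \<in> E"
  using assms unfolding connected_set_def by blast

lemma connected_set_insert:
  assumes "sym E" and conn: "connected_set E T" and "u \<in> T" "(u, v) \<in> E"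
  shows "connected_set E (insert v T)"
proof (cases "v \<in> T")
  case True
  then show ?thesis using conn by (simp add: insert_absorb)
next
  case False
  have vu: "(v, u) \<in> E" using assms(1,4) by (rule symD)
  have "\<exists>a\<in>B. \<exists>b\<in>insert v T - B. (a, b) \<in> E" if B: "B \<noteq> {}" "B \<subset> insert v T" for B
  proof -
    consider "B \<inter> T = {}" | "T \<subseteq> B" | "B \<inter> T \<noteq> {}" "B \<inter> T \<subset> T" by blast
    then show ?thesis
    proof cases
      case 1
      then have "B = {v}" using B by blast
      then show ?thesis using vu \<open>u \<in> T\<close> False by blast
    next
      case 2
      then have "v \<notin> B" using B by blast
      then show ?thesis using 2 assms(3,4) by blast
    next
      case 3
      obtain a b where "a \<in> B \<inter> T" "b \<in> T - B \<inter> T" "(a, b) \<in> E"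
        using connected_set_edge[OF conn 3] by blast
      then show ?thesis by blast
    qed
  qed
  then show ?thesis unfolding connected_set_def by blast
qed

text \<open>
  A proper connected subset containing \<open>a\<close> that is as large as possible can only miss one vertex:
  some edge leaves it, and adding the end of this edge gives a connected set again.
\<close>
lemma exists_non_cut_vertex:
  assumes "sym E" "finite T" and conn: "connected_set E T" and "a \<in> T" "T \<noteq> {a}"
  shows "\<exists>t\<in>T - {a}. connected_set E (T - {t})"
proof -
  define F where "F = {U. a \<in> U \<and> U \<subset> T \<and> connected_set E U}"
  have "F \<subseteq> Pow T" by (auto simp: F_def)
  then have "finite F" using \<open>finite T\<close> by (simp add: finite_subset)
  moreover have "{a} \<in> F" using assms(4,5) by (auto simp: F_def connected_set_singleton)
  ultimately obtain U where "U \<in> F" and max: "\<And>W. W \<in> F \<Longrightarrow> U \<subseteq> W \<Longrightarrow> U = W"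
    using finite_has_maximal[of F] by blast
  then have U: "a \<in> U" "U \<subset> T" "connected_set E U" by (auto simp: F_def)
  obtain u w where uw: "u \<in> U" "w \<in> T - U" "(u, w) \<in> E"
    using connected_set_edge[OF conn] U(1,2) by (metis empty_iff)
  have "connected_set E (insert w U)"
    using connected_set_insert[OF \<open>sym E\<close> U(3) uw(1,3)] .
  then have "insert w U = T"
    using max[of "insert w U"] U uw by (auto simp: F_def)
  then have "T - {w} = U" using uw by blast
  then show ?thesis using U uw by auto
qed

section \<open>Tripods\<close>

definition claw_free :: "'a rel \<Rightarrow> bool" where
  "claw_free E \<longleftrightarrow> (\<forall>c p q r. (c, p) \<in> E \<and> (c, q) \<in> E \<and> (c, r) \<in> E \<and> p \<noteq> q \<and> p \<noteq> r \<and> q \<noteq> r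
     \<longrightarrow> (p, q) \<in> E \<or> (p, r) \<in> E \<or> (q, r) \<in> E)"

text \<open>
  In a symmetric loopless relation the listed adjacencies and non-adjacencies force the six vertices
  to be distinct, which makes this the usual notion there.
\<close>
definition net_free :: "'a rel \<Rightarrow> bool" where
  "net_free E \<longleftrightarrow> (\<forall>a b c p q r.
     (a, b) \<in> E \<and> (b, c) \<in> E \<and> (c, a) \<in> E \<and> (a, p) \<in> E \<and> (b, q) \<in> E \<and> (c, r) \<in> E
     \<longrightarrow> (a, q) \<in> E \<or> (a, r) \<in> E \<or> (b, p) \<in> E \<or> (b, r) \<in> E \<or> (c, p) \<in> E \<or> (c, q) \<in> E
       \<or> (p, q) \<in> E \<or> (p, r) \<in> E \<or> (q, r) \<in> E)"

text \<open>
  The far ends \<open>x i\<close> and \<open>x j\<close> of two legs may be adjacent, since they never occur together in the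
  claws and nets found below.
\<close>
definition tripod :: "'a rel \<Rightarrow> 'a set \<Rightarrow> (nat \<Rightarrow> 'a) \<Rightarrow> (nat \<Rightarrow> 'a) \<Rightarrow> bool" where
  "tripod E T y x \<longleftrightarrow> finite T \<and> connected_set E T \<and>
     (\<forall>i<3. y i \<notin> T \<and> x i \<notin> T \<and> (y i, x i) \<in> E \<and> (\<exists>t\<in>T. (t, y i) \<in> E) \<and> (\<forall>t\<in>T. (t, x i) \<notin> E)) \<and>
     (\<forall>i<3. \<forall>j<3. i \<noteq> j \<longrightarrow> (y i, y j) \<notin> E \<and> (y i, x j) \<notin> E)"

lemma tripodD:
  assumes "tripod E T y x"
  shows "finite T" "connected_set E T"
    and "i < 3 \<Longrightarrow> y i \<notin> T" "i < 3 \<Longrightarrow> x i \<notin> T" "i < 3 \<Longrightarrow> (y i, x i) \<in> E"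
    and "i < 3 \<Longrightarrow> \<exists>t\<in>T. (t, y i) \<in> E" "i < 3 \<Longrightarrow> t \<in> T \<Longrightarrow> (t, x i) \<notin> E"
    and "i < 3 \<Longrightarrow> j < 3 \<Longrightarrow> i \<noteq> j \<Longrightarrow> (y i, y j) \<notin> E"
    and "i < 3 \<Longrightarrow> j < 3 \<Longrightarrow> i \<noteq> j \<Longrightarrow> (y i, x j) \<notin> E"
  using assms by (simp_all add: tripod_def)

text \<open>
  If deleting the non-cut vertex \<open>t\<close> does not leave a tripod with the same legs, some leg \<open>i\<close> is
  attached to the body only at \<open>t\<close>. That leg can then swallow \<open>t\<close>, unless \<open>t\<close> also attaches another
  leg, whose first vertex would then be adjacent to the first vertex of the lengthened leg.
\<close>
lemma tripod_shrink:
  assumes "sym E" and tri: "tripod E T y x" and t: "t \<in> T" "connected_set E (T - {t})"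
  shows "(\<exists>y' x'. tripod E (T - {t}) y' x') \<or>
    (\<exists>i<3. \<exists>j<3. i \<noteq> j \<and> (t, y i) \<in> E \<and> (\<forall>s\<in>T. (s, y i) \<in> E \<longrightarrow> s = t) \<and> (t, y j) \<in> E)"
proof (cases "\<forall>i<3. \<exists>s\<in>T - {t}. (s, y i) \<in> E")
  case True
  have "tripod E (T - {t}) y x"
    using tri t(2) True unfolding tripod_def by simp
  then show ?thesis by blast
next
  case False
  then obtain i where i: "i < 3" and only: "\<And>s. s \<in> T \<Longrightarrow> (s, y i) \<in> E \<Longrightarrow> s = t" by blast
  then have ti: "(t, y i) \<in> E" using tripodD(6)[OF tri i] by blast
  show ?thesis
  proof (cases "\<exists>j<3. i \<noteq> j \<and> (t, y j) \<in> E")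
    case True
    then show ?thesis using i ti only by blast
  next
    case False
    then have other: "(t, y j) \<notin> E" "(y j, t) \<notin> E" if "j < 3" "j \<noteq> i" for j
      using that symD[OF \<open>sym E\<close>] by metis+
    have "T - {t} \<noteq> {}" using t(2) by (simp add: connected_set_def)
    then obtain u v where "u \<in> {t}" "v \<in> T - {t}" "(u, v) \<in> E"
      using connected_set_edge[OF tripodD(2)[OF tri], of "{t}"] t(1) by blast
    then have nbr: "\<exists>s\<in>T - {t}. (s, t) \<in> E" using symD[OF \<open>sym E\<close>] by blast
    \<comment> \<open>Leg \<open>i\<close> now starts with \<open>t, y i\<close>; as \<open>t\<close> was the only neighbour of \<open>y i\<close> in \<open>T\<close>, the new
      far end \<open>y i\<close> is not adjacent to the smaller body.\<close>
    have "tripod E (T - {t}) (y(i := t)) (x(i := y i))"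
      unfolding tripod_def
    proof (intro conjI allI impI)
      fix k :: nat assume k: "k < 3"
      show "(y(i := t)) k \<notin> T - {t}" "(x(i := y i)) k \<notin> T - {t}"
        using tripodD(3,4)[OF tri k] tripodD(3)[OF tri i] by auto
      show "((y(i := t)) k, (x(i := y i)) k) \<in> E"
        using tripodD(5)[OF tri k] ti by auto
      show "\<exists>s\<in>T - {t}. (s, (y(i := t)) k) \<in> E"
        using nbr tripodD(6)[OF tri k] other(1)[OF k] by (cases "k = i") auto
      show "\<forall>s\<in>T - {t}. (s, (x(i := y i)) k) \<notin> E"
        using tripodD(7)[OF tri k] only by auto
    next
      fix k l :: nat assume kl: "k < 3" "l < 3" "k \<noteq> l"
      show "((y(i := t)) k, (y(i := t)) l) \<notin> E"
        using other kl tripodD(8)[OF tri kl] by auto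
      show "((y(i := t)) k, (x(i := y i)) l) \<notin> E"
        using kl tripodD(8,9)[OF tri kl] tripodD(7)[OF tri kl(2) t(1)] by auto
    qed (use tripodD(1)[OF tri] t(2) in auto)
    then show ?thesis by blast
  qed
qed

lemma no_tripod:
  assumes "sym E" and claw: "claw_free E" and net: "net_free E"
  shows "\<not> tripod E T y x"
proof (induction "card T" arbitrary: T y x rule: less_induct)
  case less
  show ?case
  proof
    assume tri: "tripod E T y x"
    note D = tripodD[OF tri]
    have sm: "\<And>a b. (a, b) \<in> E \<Longrightarrow> (b, a) \<in> E" using \<open>sym E\<close> by (rule symD)
    have y_neq: "y i \<noteq> y j" if "i < 3" "j < 3" "i \<noteq> j" for i j
      using D(5)[OF that(2)] D(9)[OF that] by auto
    have clawD: False if "(c, p) \<in> E" "(c, q) \<in> E" "(c, r) \<in> E" "p \<noteq> q" "p \<noteq> r" "q \<noteq> r"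
      "(p, q) \<notin> E" "(p, r) \<notin> E" "(q, r) \<notin> E" for c p q r
      using claw that unfolding claw_free_def by blast
    obtain a where a: "a \<in> T" using D(2) by (auto simp: connected_set_def)
    show False
    proof (cases "T = {a}")
      case True
      then have "(a, y i) \<in> E" if "i < 3" for i using D(6)[OF that] by auto
      then show False
        using clawD[of a "y 0" "y 1" "y 2"] y_neq D(8) by simp
    next
      case False
      obtain t where t: "t \<in> T" "connected_set E (T - {t})"
        using exists_non_cut_vertex[OF \<open>sym E\<close> D(1,2) a False] by blast
      then have "T \<noteq> {t}" by (auto simp: connected_set_def)
      then obtain t' where t': "t' \<in> T" "t' \<noteq> t" "connected_set E (T - {t'})"
        using exists_non_cut_vertex[OF \<open>sym E\<close> D(1,2) t(1)] by blast
      have smaller: "\<not> tripod E (T - {s}) y' x'" if "s \<in> T" for s y' x'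
        using less.hyps[of "T - {s}"] that D(1) by (meson card_Diff1_less)
      obtain i j where i: "i < 3" "(t, y i) \<in> E" "\<And>s. s \<in> T \<Longrightarrow> (s, y i) \<in> E \<Longrightarrow> s = t"
        and j: "j < 3" "i \<noteq> j" "(t, y j) \<in> E"
        using tripod_shrink[OF \<open>sym E\<close> tri t] smaller[OF t(1)] by blast
      obtain i' j' where i': "i' < 3" "(t', y i') \<in> E" "\<And>s. s \<in> T \<Longrightarrow> (s, y i') \<in> E \<Longrightarrow> s = t'"
        and j': "j' < 3" "i' \<noteq> j'" "(t', y j') \<in> E"
        using tripod_shrink[OF \<open>sym E\<close> tri t'(1,3)] smaller[OF t'(1)] by blast
      have ne: "i \<noteq> i'" "i' \<noteq> j" "i \<noteq> j'"
        using i(2,3) i'(2,3) j(3) j'(3) t(1) t'(1,2) by metis+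
      \<comment> \<open>Both \<open>j\<close> and \<open>j'\<close> are the index in \<open>{0, 1, 2}\<close> that differs from \<open>i\<close> and \<open>i'\<close>.\<close>
      then have "j' = j" using i(1) i'(1) j(1,2) j'(1,2) by presburger
      note j' = j'[unfolded this]
      have tt': "(t, t') \<in> E"
      proof (rule ccontr)
        assume "(t, t') \<notin> E"
        then show False
          using clawD[of "y j" "x j" t t'] D(4,5,7)[OF j(1)] j(3) j'(3) t(1) t'(1,2) sm by metis
      qed
      have no: "(t, y i') \<notin> E" "(t', y i) \<notin> E" "(t, x j) \<notin> E" "(t', x j) \<notin> E"
        "(y j, y i) \<notin> E" "(y j, y i') \<notin> E" "(y i, y i') \<notin> E" "(y i, x j) \<notin> E" "(y i', x j) \<notin> E"
        using i(3)[OF t'(1)] i'(3)[OF t(1)] t'(2) D(7)[OF j(1)] t(1) t'(1) D(8) D(9)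
          i(1) i'(1) j(1,2) ne by metis+
      show False
        using net tt' sm[OF j(3)] j'(3) i(2) i'(2) D(5)[OF j(1)] no unfolding net_free_def by meson
    qed
  qed
qed

section \<open>Claws and nets as induced subgraphs\<close>

lemma induced_free_no_embedding:
  fixes f :: "'b \<Rightarrow> 'a"
  assumes free: "induced_free H G" and "pair_wf_digraph G" "pair_wf_digraph H"
    and inj: "inj_on f (pverts H)" and sub: "f ` pverts H \<subseteq> pverts G"
    and adj: "\<And>u v. u \<in> pverts H \<Longrightarrow> v \<in> pverts H \<Longrightarrow> (f u, f v) \<in> parcs G \<longleftrightarrow> (u, v) \<in> parcs H"
  shows False
proof -
  interpret G: pair_wf_digraph G by fact
  interpret H: pair_wf_digraph H by fact
  define h where "h = \<lparr>iso_verts = f, iso_arcs = map_prod f f, iso_head = snd, iso_tail = fst\<rparr>"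
  have "inj_on (map_prod f f) (parcs H)"
    by (rule inj_on_subset[OF map_prod_inj_on[OF inj inj]]) (auto dest: H.wellformed')
  then have iso: "pre_digraph.digraph_isomorphism (with_proj H) h"
    using inj H.wf_digraph_axioms
    by (auto simp: pre_digraph.digraph_isomorphism_def h_def)
  have "app_iso h (with_proj H) = with_proj G \<restriction> (f ` pverts H)"
  proof -
    have "map_prod f f ` parcs H = {e \<in> parcs G. fst e \<in> f ` pverts H \<and> snd e \<in> f ` pverts H}"
    proof (intro set_eqI iffI)
      fix e assume "e \<in> map_prod f f ` parcs H"
      then show "e \<in> {e \<in> parcs G. fst e \<in> f ` pverts H \<and> snd e \<in> f ` pverts H}"
        using adj H.wellformed' by auto
    next
      fix e assume "e \<in> {e \<in> parcs G. fst e \<in> f ` pverts H \<and> snd e \<in> f ` pverts H}"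
      then obtain u v where "e = (f u, f v)" "u \<in> pverts H" "v \<in> pverts H" "(f u, f v) \<in> parcs G"
        by (cases e) auto
      then show "e \<in> map_prod f f ` parcs H" using adj by force
    qed
    then show ?thesis by (simp add: app_iso_def h_def induce_subgraph_def)
  qed
  then have "digraph_iso (with_proj H) (with_proj G \<restriction> (f ` pverts H))"
    using iso unfolding digraph_iso_def by metis
  then have "digraph_iso (with_proj G \<restriction> (f ` pverts H)) (with_proj H)"
    using digraph_iso_swap[OF H.wf_digraph_axioms] by blast
  moreover have "induced_subgraph (with_proj G \<restriction> (f ` pverts H)) (with_proj G)"
    using G.induced_induce sub by simp
  ultimately show False using free unfolding induced_free_def by blast
qed

lemma claw_graph_verts: "pverts claw_graph = {0, 1, 2, 3}"
  and claw_graph_arcs: "parcs claw_graph = {(0, 1), (1, 0), (0, 2), (2, 0), (0, 3), (3, 0)}"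
  by (auto simp: claw_graph_def parcs_mk_symmetric)

lemma net_graph_verts: "pverts net_graph = {0, 1, 2, 3, 4, 5}"
  and net_graph_arcs: "parcs net_graph = {(0, 1), (1, 0), (1, 2), (2, 1), (2, 0), (0, 2),
    (0, 3), (3, 0), (1, 4), (4, 1), (2, 5), (5, 2)}"
  by (auto simp: net_graph_def parcs_mk_symmetric)

lemma pair_wf_claw_graph: "pair_wf_digraph claw_graph"
  by unfold_locales (auto simp: claw_graph_verts claw_graph_arcs)

lemma pair_wf_net_graph: "pair_wf_digraph net_graph"
  by unfold_locales (auto simp: net_graph_verts net_graph_arcs)

context pair_bidirected_digraph
begin

lemma arcs_sym: "sym (parcs G)"
  by (auto intro: symI arcs_symmetric)

lemma arcs_irrefl: "(v, v) \<notin> parcs G"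
  using pair_no_loops by fastforce

lemma claw_free_parcs:
  assumes "induced_free claw_graph G"
  shows "claw_free (parcs G)"
proof -
  have False if *: "(c, p) \<in> parcs G" "(c, q) \<in> parcs G" "(c, r) \<in> parcs G"
    "p \<noteq> q" "p \<noteq> r" "q \<noteq> r" "(p, q) \<notin> parcs G" "(p, r) \<notin> parcs G" "(q, r) \<notin> parcs G" for c p q r
  proof -
    have **: "(p, c) \<in> parcs G" "(q, c) \<in> parcs G" "(r, c) \<in> parcs G"
      "(q, p) \<notin> parcs G" "(r, p) \<notin> parcs G" "(r, q) \<notin> parcs G"
      using * arcs_symmetric by blast+
    let ?f = "(!) [c, p, q, r]"
    have dist: "distinct [c, p, q, r]" using * arcs_irrefl by (simp, metis)
    have "inj_on ?f {0, 1, 2, 3}" using dist by simp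
    moreover have "?f ` {0, 1, 2, 3} \<subseteq> pverts G" using * ** in_arcsD1 by simp
    moreover have "\<forall>u\<in>{0, 1, 2, 3}. \<forall>v\<in>{0, 1, 2, 3}.
        (?f u, ?f v) \<in> parcs G \<longleftrightarrow> (u, v) \<in> parcs claw_graph"
      by (simp add: claw_graph_arcs * ** arcs_irrefl)
    ultimately show False
      by (intro induced_free_no_embedding[OF assms pair_wf_digraph_axioms pair_wf_claw_graph, of ?f])
        (simp_all only: claw_graph_verts)
  qed
  then show ?thesis unfolding claw_free_def by blast
qed

lemma net_free_parcs:
  assumes "induced_free net_graph G"
  shows "net_free (parcs G)"
proof -
  have False if *: "(a, b) \<in> parcs G" "(b, c) \<in> parcs G" "(c, a) \<in> parcs G"
    "(a, p) \<in> parcs G" "(b, q) \<in> parcs G" "(c, r) \<in> parcs G"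
    "(a, q) \<notin> parcs G" "(a, r) \<notin> parcs G" "(b, p) \<notin> parcs G" "(b, r) \<notin> parcs G"
    "(c, p) \<notin> parcs G" "(c, q) \<notin> parcs G"
    "(p, q) \<notin> parcs G" "(p, r) \<notin> parcs G" "(q, r) \<notin> parcs G" for a b c p q r
  proof -
    have **: "(b, a) \<in> parcs G" "(c, b) \<in> parcs G" "(a, c) \<in> parcs G"
      "(p, a) \<in> parcs G" "(q, b) \<in> parcs G" "(r, c) \<in> parcs G"
      "(q, a) \<notin> parcs G" "(r, a) \<notin> parcs G" "(p, b) \<notin> parcs G" "(r, b) \<notin> parcs G"
      "(p, c) \<notin> parcs G" "(q, c) \<notin> parcs G"
      "(q, p) \<notin> parcs G" "(r, p) \<notin> parcs G" "(r, q) \<notin> parcs G"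
      using * arcs_symmetric by blast+
    let ?f = "(!) [a, b, c, p, q, r]"
    have dist: "distinct [a, b, c, p, q, r]" using * ** arcs_irrefl by (simp, metis)
    have "inj_on ?f {0, 1, 2, 3, 4, 5}" using dist by simp
    moreover have "?f ` {0, 1, 2, 3, 4, 5} \<subseteq> pverts G" using * ** in_arcsD1 by simp
    moreover have "\<forall>u\<in>{0, 1, 2, 3, 4, 5}. \<forall>v\<in>{0, 1, 2, 3, 4, 5}.
        (?f u, ?f v) \<in> parcs G \<longleftrightarrow> (u, v) \<in> parcs net_graph"
      by (simp add: net_graph_arcs * ** arcs_irrefl)
    ultimately show False
      by (intro induced_free_no_embedding[OF assms pair_wf_digraph_axioms pair_wf_net_graph, of ?f])
        (simp_all only: net_graph_verts)
  qed
  then show ?thesis unfolding net_free_def by blast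
qed

section \<open>Rays and separators\<close>

abbreviation linked :: "'a set \<Rightarrow> 'a \<Rightarrow> 'a \<Rightarrow> bool" where
  "linked S u v \<equiv> reachable (with_proj G \<restriction> (pverts G - S)) u v"

lemma arcs_ends_minus:
  "arcs_ends (with_proj G \<restriction> W) = parcs G \<inter> W \<times> W"
  by (auto simp: arcs_ends_conv image_iff)

lemma linked_sym: "linked S u v \<Longrightarrow> linked S v u"
  by (rule symmetric_reachable)
    (auto simp: symmetric_def arcs_ends_minus intro!: symI arcs_symmetric)

lemma linked_trans: "linked S u v \<Longrightarrow> linked S v w \<Longrightarrow> linked S u w"
  unfolding reachable_def by (rule rtrancl_on_trans)

lemma linked_refl: "u \<in> pverts G \<Longrightarrow> u \<notin> S \<Longrightarrow> linked S u u"
  unfolding reachable_def by auto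

lemma linked_in: "linked S u v \<Longrightarrow> v \<in> pverts G - S"
  by (erule reachable_in_vertsE) simp

lemma linked_step:
  assumes "linked S u v" "(v, w) \<in> parcs G" "w \<notin> S"
  shows "linked S u w"
proof -
  have "v \<in> pverts G - S" "w \<in> pverts G - S"
    using linked_in[OF assms(1)] in_arcsD2[OF assms(2)] assms(3) by auto
  then have "(v, w) \<in> arcs_ends (with_proj G \<restriction> (pverts G - S))"
    using assms(2) by (simp add: arcs_ends_minus)
  then show ?thesis
    using assms(1) \<open>w \<in> pverts G - S\<close> unfolding reachable_def
    by (metis rtrancl_on_into_rtrancl_on induce_subgraph_verts)
qed

lemma linked_avoids: "linked S u v \<Longrightarrow> v \<notin> S"
  using linked_in by blast

lemma linked_antimono:
  assumes "linked S u v" "S' \<subseteq> S" shows "linked S' u v"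
  using assms(1) unfolding reachable_def
  by (rule rtrancl_on_mono[rotated 2]) (use assms(2) in \<open>auto simp: arcs_ends_minus\<close>)

lemma component_minus_of:
  assumes "u \<in> pverts G" "u \<notin> S"
  shows "{v. linked S u v} \<in> components_minus G S"
proof -
  interpret M: wf_digraph "with_proj G \<restriction> (pverts G - S)" by (rule wellformed_induce_subgraph)
  have "{v. linked S u v} = M.scc_of u" using linked_sym by (auto simp: M.scc_of_def)
  then show ?thesis
    using M.scc_of_in_sccs_verts[of u] assms by (simp add: components_minus_def)
qed

lemma rayD:
  assumes "r \<in> rays G"
  shows "inj r" "r n \<in> pverts G" "(r n, r (Suc n)) \<in> parcs G"
  using assms by (auto simp: rays_def)

lemma ray_tail_avoids_finite:
  assumes "r \<in> rays G" "finite S"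
  shows "\<exists>m. \<forall>k\<ge>m. r k \<notin> S"
proof -
  have "finite (r -` S)" using assms rayD(1) by (simp add: finite_vimageI)
  then obtain m where "\<forall>k\<in>r -` S. k < m" using finite_nat_set_iff_bounded by blast
  then show ?thesis by (intro exI[of _ m]) (auto dest: leD)
qed

lemma ray_tail_linked:
  assumes "r \<in> rays G" "\<And>k. k \<ge> m \<Longrightarrow> r k \<notin> S" "m \<le> n"
  shows "linked S (r m) (r n)"
  using assms(3)
proof (induction n rule: dec_induct)
  case base
  then show ?case using rayD(2)[OF assms(1)] assms(2) by (intro linked_refl) auto
next
  case (step n)
  then show ?case
    using linked_step[OF step.IH rayD(3)[OF assms(1)]] assms(2)[of "Suc n"] by simp
qed

lemma ray_equiv_iff:
  "(r, s) \<in> ray_equiv G \<longleftrightarrow> r \<in> rays G \<and> s \<in> rays G \<and>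
     (\<forall>S. finite S \<and> S \<subseteq> pverts G \<longrightarrow>
        (\<exists>C\<in>components_minus G S. \<exists>m n. r ` {m..} \<subseteq> C \<and> s ` {n..} \<subseteq> C))"
  by (simp add: ray_equiv_def)

text \<open>
  If tails of both rays avoid \<open>S\<close>, each lies in one component of \<open>G - S\<close>, so a single path avoiding
  \<open>S\<close> between them would put both tails into the same component.
\<close>
lemma ray_separator:
  assumes r: "r \<in> rays G" and s: "s \<in> rays G" and "(r, s) \<notin> ray_equiv G"
  shows "\<exists>S. finite S \<and> S \<subseteq> pverts G \<and>
    (\<forall>m n. (\<forall>k\<ge>m. r k \<notin> S) \<longrightarrow> (\<forall>k\<ge>n. s k \<notin> S) \<longrightarrow> \<not> linked S (r m) (s n))"
proof -
  obtain S where S: "finite S" "S \<subseteq> pverts G"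
    and none: "\<not> (\<exists>C\<in>components_minus G S. \<exists>m n. r ` {m..} \<subseteq> C \<and> s ` {n..} \<subseteq> C)"
    using assms by (auto simp only: ray_equiv_iff)
  have "\<not> linked S (r m) (s n)" if m: "\<forall>k\<ge>m. r k \<notin> S" and n: "\<forall>k\<ge>n. s k \<notin> S" for m n
  proof
    assume l: "linked S (r m) (s n)"
    have "r ` {m..} \<subseteq> {v. linked S (r m) v}"
      using ray_tail_linked[OF r] m by auto
    moreover have "s ` {n..} \<subseteq> {v. linked S (r m) v}"
      using ray_tail_linked[OF s] n linked_trans[OF l] by auto
    moreover have "{v. linked S (r m) v} \<in> components_minus G S"
      using component_minus_of rayD(2)[OF r] m by simp
    ultimately show False using none by blast
  qed
  then show ?thesis using S by blast
qed

lemma ray_equiv_sym: "sym (ray_equiv G)"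
  by (rule symI) (unfold ray_equiv_iff, meson)

text \<open>
  The two components that witness \<open>r \<sim> s\<close> and \<open>s \<sim> t\<close> both contain a tail of \<open>s\<close>, hence agree.
\<close>
lemma ray_equiv_trans: "trans (ray_equiv G)"
proof (rule transI)
  fix r s t assume rs: "(r, s) \<in> ray_equiv G" and st: "(s, t) \<in> ray_equiv G"
  have "\<exists>C\<in>components_minus G S. \<exists>m n. r ` {m..} \<subseteq> C \<and> t ` {n..} \<subseteq> C"
    if S: "finite S" "S \<subseteq> pverts G" for S
  proof -
    interpret M: wf_digraph "with_proj G \<restriction> (pverts G - S)" by (rule wellformed_induce_subgraph)
    obtain C m n where C: "C \<in> components_minus G S" "r ` {m..} \<subseteq> C" "s ` {n..} \<subseteq> C"
      using rs S by (auto simp only: ray_equiv_iff)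
    obtain C' m' n' where C': "C' \<in> components_minus G S" "s ` {m'..} \<subseteq> C'" "t ` {n'..} \<subseteq> C'"
      using st S by (auto simp only: ray_equiv_iff)
    have "s (max n m') \<in> C \<inter> C'" using C(3) C'(2) by auto
    then have "C = C'"
      using M.sccs_verts_disjoint C(1) C'(1) unfolding components_minus_def by blast
    then show ?thesis using C C' by blast
  qed
  then show "(r, t) \<in> ray_equiv G" using rs st by (simp add: ray_equiv_iff)
qed

section \<open>From three ends to a tripod\<close>

lemma arcs_rtrancl_of_connected:
  assumes "Digraph_Component.connected (with_proj G)" "u \<in> pverts G" "v \<in> pverts G"
  shows "(u, v) \<in> (parcs G)\<^sup>*"
proof -
  have "reachable (with_proj (mk_symmetric (with_proj G))) u v"
    using assms by (simp add: connected_def strongly_connected_def)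
  moreover have "parcs (mk_symmetric (with_proj G)) = parcs G"
    using arcs_symmetric by (auto simp: parcs_mk_symmetric)
  ultimately show ?thesis by (auto dest: reachable_rtranclI)
qed

text \<open>
  From a fixed root, add the vertices on a path to each element of \<open>S\<close> in turn.
\<close>
lemma finite_connected_superset:
  assumes conn: "Digraph_Component.connected (with_proj G)" and "finite S" "S \<subseteq> pverts G"
  shows "\<exists>T. finite T \<and> S \<subseteq> T \<and> T \<subseteq> pverts G \<and> connected_set (parcs G) T"
proof -
  obtain a where a: "a \<in> pverts G"
    using conn by (auto simp: connected_def strongly_connected_def)
  have extend: "\<exists>T'. finite T' \<and> T \<subseteq> T' \<and> v \<in> T' \<and> T' \<subseteq> pverts G \<and> connected_set (parcs G) T'"
    if "(a, v) \<in> (parcs G)\<^sup>*" "finite T" "a \<in> T" "T \<subseteq> pverts G" "connected_set (parcs G) T" for T v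
    using that(1)
  proof induction
    case base
    then show ?case using that by blast
  next
    case (step v w)
    then obtain T' where "finite T'" "T \<subseteq> T'" "v \<in> T'" "T' \<subseteq> pverts G"
      "connected_set (parcs G) T'" by blast
    then show ?case
      using connected_set_insert[OF arcs_sym _ _ step(2)] in_arcsD2[OF step(2)]
      by (intro exI[of _ "insert w T'"]) auto
  qed
  have "\<exists>T. finite T \<and> insert a S \<subseteq> T \<and> T \<subseteq> pverts G \<and> connected_set (parcs G) T"
    using assms(2,3)
  proof (induction S)
    case empty
    show ?case by (intro exI[of _ "{a}"]) (simp add: connected_set_singleton a)
  next
    case (insert v S)
    then obtain T where T: "finite T" "insert a S \<subseteq> T" "T \<subseteq> pverts G" "connected_set (parcs G) T" by auto
    have "(a, v) \<in> (parcs G)\<^sup>*" using arcs_rtrancl_of_connected[OF conn a] insert.prems by simp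
    then have "\<exists>T'. finite T' \<and> T \<subseteq> T' \<and> v \<in> T' \<and> T' \<subseteq> pverts G \<and> connected_set (parcs G) T'"
      using extend[of v T] T by simp
    then show ?case using T(2) by (meson insert_subset order_trans)
  qed
  then show ?thesis by blast
qed

text \<open>
  Walking from \<open>w\<close> towards \<open>T\<close>, the first vertex with a neighbour in \<open>T\<close> is \<open>y\<close> and its predecessor
  is \<open>x\<close>.
\<close>
lemma exit_path:
  assumes "(w, v) \<in> (parcs G)\<^sup>*" "v \<in> T" "w \<in> pverts G" "w \<notin> T" "\<And>t. t \<in> T \<Longrightarrow> (t, w) \<notin> parcs G"
  shows "\<exists>y x. linked T w y \<and> linked T w x \<and> (y, x) \<in> parcs G \<and>
    (\<exists>t\<in>T. (t, y) \<in> parcs G) \<and> (\<forall>t\<in>T. (t, x) \<notin> parcs G)"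
    (is ?exit)
proof -
  have "(linked T w v \<and> (\<forall>t\<in>T. (t, v) \<notin> parcs G)) \<or> ?exit"
    using assms(1)
  proof induction
    case base
    then show ?case using assms(3-5) linked_refl by blast
  next
    case (step v u)
    show ?case
    proof (rule disjCI)
      assume no: "\<not> ?exit"
      then have v: "linked T w v" "\<forall>t\<in>T. (t, v) \<notin> parcs G" using step.IH by auto
      have "u \<notin> T" using v(2) arcs_symmetric[OF step.hyps(2)] by blast
      then have "linked T w u" using linked_step[OF v(1) step.hyps(2)] by blast
      then show "linked T w u \<and> (\<forall>t\<in>T. (t, u) \<notin> parcs G)"
        using no v arcs_symmetric[OF step.hyps(2)] by blast
    qed
  qed
  then show ?thesis using linked_avoids assms(2) by blast
qed

lemma tripod_of_inequivalent_rays: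
  assumes lf: "locally_finite_graph G" and conn: "Digraph_Component.connected (with_proj G)"
    and rays: "\<And>i. i < (3::nat) \<Longrightarrow> r i \<in> rays G"
    and ineq: "\<And>i j. i < 3 \<Longrightarrow> j < 3 \<Longrightarrow> i \<noteq> j \<Longrightarrow> (r i, r j) \<notin> ray_equiv G"
  shows "\<exists>T y x. tripod (parcs G) T y x"
proof -
  define separates where "separates S i j \<longleftrightarrow>
    (\<forall>m n. (\<forall>k\<ge>m. r i k \<notin> S) \<longrightarrow> (\<forall>k\<ge>n. r j k \<notin> S) \<longrightarrow> \<not> linked S (r i m) (r j n))" for S i j
  define I where "I = {(i, j). i < (3::nat) \<and> j < 3 \<and> i \<noteq> j}"
  have "finite I" by (rule finite_subset[of _ "{..<3} \<times> {..<3}"]) (auto simp: I_def)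
  have "\<forall>p\<in>I. \<exists>S. finite S \<and> S \<subseteq> pverts G \<and> separates S (fst p) (snd p)"
    using ray_separator[OF rays rays ineq] by (auto simp: I_def separates_def)
  then obtain S where S: "\<And>p. p \<in> I \<Longrightarrow> finite (S p)" "\<And>p. p \<in> I \<Longrightarrow> S p \<subseteq> pverts G"
    "\<And>p. p \<in> I \<Longrightarrow> separates (S p) (fst p) (snd p)"
    by metis
  have "finite (\<Union>p\<in>I. S p)" using \<open>finite I\<close> S(1) by simp
  moreover have "(\<Union>p\<in>I. S p) \<subseteq> pverts G" using S(2) by (rule UN_least)
  ultimately have "\<exists>T. finite T \<and> (\<Union>p\<in>I. S p) \<subseteq> T \<and> T \<subseteq> pverts G \<and> connected_set (parcs G) T"
    by (rule finite_connected_superset[OF conn])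
  then obtain T where T: "finite T" "(\<Union>p\<in>I. S p) \<subseteq> T" "connected_set (parcs G) T" "T \<subseteq> pverts G"
    by blast
  have fin_nbrs: "finite {v. (t, v) \<in> parcs G}" for t
  proof (cases "t \<in> pverts G")
    case True
    then have "finite (out_arcs (with_proj G) t)" using lf by (simp add: locally_finite_graph_def)
    then have "finite (snd ` out_arcs (with_proj G) t)" by simp
    moreover have "{v. (t, v) \<in> parcs G} \<subseteq> snd ` out_arcs (with_proj G) t"
      by (force simp: out_arcs_def)
    ultimately show ?thesis by (rule rev_finite_subset)
  next
    case False
    then have "{v. (t, v) \<in> parcs G} = {}" using in_arcsD1 by auto
    then show ?thesis by simp
  qed
  \<comment> \<open>\<open>P\<close> is \<open>T\<close> together with its neighbourhood. A tail that avoids \<open>P\<close> starts at a vertex \<open>w i\<close>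
    from which any path to \<open>T\<close> must pass through a vertex not adjacent to \<open>T\<close> before one that is.\<close>
  define P where "P = T \<union> (\<Union>t\<in>T. {v. (t, v) \<in> parcs G})"
  have "finite P" using T(1) fin_nbrs by (simp add: P_def)
  then have "\<exists>m. \<forall>k\<ge>m. r i k \<notin> P" if "i < 3" for i
    using ray_tail_avoids_finite[OF rays[OF that]] by blast
  then obtain m where m: "\<And>i k. i < 3 \<Longrightarrow> k \<ge> m i \<Longrightarrow> r i k \<notin> P" by metis
  define w where "w i = r i (m i)" for i
  have w: "w i \<in> pverts G" "w i \<notin> T" "\<And>t. t \<in> T \<Longrightarrow> (t, w i) \<notin> parcs G" if "i < 3" for i
    using rayD(2)[OF rays[OF that]] m[OF that, of "m i"] by (auto simp: w_def P_def)
  have unlinked: "\<not> linked T (w i) (w j)" if ij: "i < 3" "j < 3" "i \<noteq> j" for i j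
  proof
    assume l: "linked T (w i) (w j)"
    have "(i, j) \<in> I" using ij by (simp add: I_def)
    then have sep: "separates (S (i, j)) i j" and sub: "S (i, j) \<subseteq> T"
      using S(3)[of "(i, j)"] T(2) by auto
    have "\<forall>k\<ge>m i. r i k \<notin> S (i, j)" "\<forall>k\<ge>m j. r j k \<notin> S (i, j)"
      using m[OF ij(1)] m[OF ij(2)] sub by (auto simp: P_def)
    then have "\<not> linked (S (i, j)) (w i) (w j)"
      using sep unfolding separates_def w_def by simp
    then show False using linked_antimono[OF l sub] by simp
  qed
  obtain a where a: "a \<in> T" using T(3) by (auto simp: connected_set_def)
  have "(w i, a) \<in> (parcs G)\<^sup>*" if "i < 3" for i
    using arcs_rtrancl_of_connected[OF conn w(1)[OF that]] a T(4) by blast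
  then have "\<exists>y x. linked T (w i) y \<and> linked T (w i) x \<and> (y, x) \<in> parcs G \<and>
      (\<exists>t\<in>T. (t, y) \<in> parcs G) \<and> (\<forall>t\<in>T. (t, x) \<notin> parcs G)" if "i < 3" for i
    using exit_path[OF _ a w[OF that]] that by blast
  then obtain y x where yx: "\<And>i. i < 3 \<Longrightarrow> linked T (w i) (y i)" "\<And>i. i < 3 \<Longrightarrow> linked T (w i) (x i)"
    "\<And>i. i < 3 \<Longrightarrow> (y i, x i) \<in> parcs G" "\<And>i. i < 3 \<Longrightarrow> \<exists>t\<in>T. (t, y i) \<in> parcs G"
    "\<And>i. i < 3 \<Longrightarrow> \<forall>t\<in>T. (t, x i) \<notin> parcs G"
    by metis
  \<comment> \<open>The legs lie in different components of \<open>G - T\<close>, so there are no edges between them.\<close>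
  have apart: "(u, v) \<notin> parcs G"
    if "i < 3" "j < 3" "i \<noteq> j" "linked T (w i) u" "linked T (w j) v" for i j u v
  proof
    assume "(u, v) \<in> parcs G"
    then have "linked T (w i) v" using linked_step[OF that(4)] linked_avoids[OF that(5)] by simp
    then have "linked T (w i) (w j)" using linked_trans linked_sym[OF that(5)] by blast
    then show False using unlinked[OF that(1-3)] by simp
  qed
  have "tripod (parcs G) T y x"
    unfolding tripod_def using T(1,3) yx(3-5) apart[OF _ _ _ yx(1) yx(1)] apart[OF _ _ _ yx(1,2)]
      linked_avoids[OF yx(1)] linked_avoids[OF yx(2)] by simp
  then show ?thesis by blast
qed

end

theorem lemma3p3:
  fixes G :: "'a pair_pre_digraph"
  assumes "pair_bidirected_digraph G"
    and "locally_finite_graph G"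
    and "Digraph_Component.connected (with_proj G)"
    and "induced_free claw_graph G"
    and "induced_free net_graph G"
  shows "finite (graph_ends G) \<and> card (graph_ends G) \<le> 2"
proof (rule ccontr)
  interpret pair_bidirected_digraph G by fact
  assume "\<not> (finite (graph_ends G) \<and> card (graph_ends G) \<le> 2)"
  then have "infinite (graph_ends G) \<or> 3 \<le> card (graph_ends G)" by linarith
  then have "\<exists>B\<subseteq>graph_ends G. finite B \<and> card B = 3"
  proof
    assume "infinite (graph_ends G)"
    then show ?thesis using infinite_arbitrarily_large by metis
  next
    assume "3 \<le> card (graph_ends G)"
    then obtain B where "B \<subseteq> graph_ends G" "card B = 3" "finite B"
      by (rule obtain_subset_with_card_n)
    then show ?thesis by blast
  qed
  then obtain B where B: "B \<subseteq> graph_ends G" "finite B" "card B = 3" by blast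
  then obtain e where e: "bij_betw e {0..<3::nat} B"
    using ex_bij_betw_nat_finite[of B] by auto
  have "\<exists>r\<in>rays G. e i = ray_equiv G `` {r}" if "i < 3" for i
  proof -
    have "e i \<in> rays G // ray_equiv G"
      using bij_betwE[OF e] that B(1) by (auto simp: graph_ends_def)
    then show ?thesis unfolding quotient_def by blast
  qed
  then obtain r where r: "\<And>i. i < 3 \<Longrightarrow> r i \<in> rays G" "\<And>i. i < 3 \<Longrightarrow> e i = ray_equiv G `` {r i}"
    by metis
  have "(r i, r j) \<notin> ray_equiv G" if ij: "i < 3" "j < 3" "i \<noteq> j" for i j
  proof
    assume eq: "(r i, r j) \<in> ray_equiv G"
    have "(r i, t) \<in> ray_equiv G \<longleftrightarrow> (r j, t) \<in> ray_equiv G" for t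
      using transD[OF ray_equiv_trans eq] transD[OF ray_equiv_trans symD[OF ray_equiv_sym eq]]
      by iprover
    then have "ray_equiv G `` {r i} = ray_equiv G `` {r j}"
      by (simp add: Image_singleton)
    then have "e i = e j" using r(2) ij by simp
    then show False using bij_betw_imp_inj_on[OF e] ij by (auto dest: inj_onD)
  qed
  then obtain T y x where "tripod (parcs G) T y x"
    using tripod_of_inequivalent_rays[OF assms(2,3), of r] r(1) by metis
  then show False
    using no_tripod[OF arcs_sym claw_free_parcs[OF assms(4)] net_free_parcs[OF assms(5)]] by simp
qed

end
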